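(* Let the system $x_{k+1}=A(p_k)x_k+Bu_k$, $k\in\mathbb{N}$, be polytopic (with functions $\xi_i$ and matrices $A_i$, $i\in\mathcal{N}$). The system is poly-Q stabilizable if and only if there exist matrices $\bar{S}_i\in\mathbb{S}^{n_x}_{\succ 0}$ and $\bar{P}_i=\bar{S}_i^{-1}$, $i\in\mathcal{N}$, such that $S(\pi)=P^{-1}(\pi)$, with $P(\pi)=\sum_{i\in\mathcal{N}}\xi_i(\pi)\bar{P}_i$, satisfies $$S(\pi_+)-A(\pi)S(\pi)A^\top(\pi)+BB^\top\succ 0\quad\text{for all }\pi_+,\pi\in\mathbb{P}.$$ Moreover, in that case, the controller gain $$K(k,\bm{p})=-B^\top\big(S(p_{k+1})+BB^\top\big)^{-1}A(p_k),\quad k\in\mathbb{N},\ \bm{p}=\{p_k\}_{k\in\mathbb{N}}\in\mathcal{P},$$ renders the closed-loop system $x_{k+1}=(A(p_k)+BK(k,\bm{p}))x_k$ poly-QS with poly-QLF $V(\pi,x)=x^\top P(\pi)x$.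
   Context: Notation: $\mathbb{N}=\{0,1,2,\dots\}$; $\mathbb{S}^n$ is the set of symmetric $n\times n$ real matrices, $\mathbb{S}^n_{\succ 0}$ the positive definite ones; $M\succ 0$ means $M$ is symmetric positive definite; $P^{-1}(\pi)=(P(\pi))^{-1}$, $A^\top(\pi)=(A(\pi))^\top$. Setting: $\mathbb{P}\subseteq\mathbb{R}^{n_p}$ is a known compact set, $A\colon\mathbb{P}\to\mathbb{R}^{n_x\times n_x}$, $B\in\mathbb{R}^{n_x\times n_u}$. $\mathcal{P}$ is the set of all sequences $\bm{p}=\{p_k\}_{k\in\mathbb{N}}$ with $p_k\in\mathbb{P}$ for all $k$. Let $\mathcal{N}=\{1,\dots,N\}$. Polytopic: the system is polytopic if there exist continuous functions $\xi_i\colon\mathbb{P}\to\mathbb{R}_{\geqslant 0}$, $i\in\mathcal{N}$, with $\sum_{i\in\mathcal{N}}\xi_i(\pi)=1$ for all $\pi\in\mathbb{P}$, and matrices $A_i\in\mathbb{R}^{n_x\times n_x}$, $i\in\mathcal{N}$, such that $A(\pi)=\sum_{i\in\mathcal{N}}\xi_i(\pi)A_i$ for all $\pi\in\mathbb{P}$. Poly-QS: a system $x_{k+1}=F(k,\bm{p})x_k$ with $F\colon\mathbb{N}\times\mathcal{P}\to\mathbb{R}^{n_x\times n_x}$ is poly-quadratically stable (poly-QS) if it admits a poly-quadratic Lyapunov function (poly-QLF), i.e., a function $V(\pi,x)=x^\top P(\pi)x$ with $P(\pi)=\sum_{i\in\mathcal{N}}\xi_i(\pi)\bar{P}_i$,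 $\bar{P}_i\in\mathbb{S}^{n_x}$ (with the same functions $\xi_i$ as for $A$), such that for some $a_1,a_2,a_3>0$: $a_1\|x\|^2\leqslant V(\pi,x)\leqslant a_2\|x\|^2$ for all $\pi\in\mathbb{P}$, $x\in\mathbb{R}^{n_x}$, and $V(p_{k+1},F(k,\bm{p})x)\leqslant V(p_k,x)-a_3\|x\|^2$ for all $k\in\mathbb{N}$, $\bm{p}\in\mathcal{P}$, $x\in\mathbb{R}^{n_x}$. Poly-Q stabilizability: with state feedback $u_k=K(k,\bm{p})x_k$, the closed-loop system is $x_{k+1}=(A(p_k)+BK(k,\bm{p}))x_k$. The system is poly-Q stabilizable if there exists a function $K\colon\mathbb{N}\times\mathcal{P}\to\mathbb{R}^{n_u\times n_x}$ that renders the closed-loop system poly-QS.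
   Formalization: "Only if" fails as stated, since a poly-QLF may have indefinite P̄_i; it is proved when every ξ_i attains the value 1 on ℙ, or, for any ξ_i, from a poly-QLF whose P̄_i are all positive definite. The "if" direction and the "moreover" part are unrestricted. *)

theory Defs
  imports "HOL-Analysis.Analysis"
begin

definition sym_mat :: "real^'n^'n \<Rightarrow> bool" where
  "sym_mat M \<longleftrightarrow> transpose M = M"

definition pos_def :: "real^'n^'n \<Rightarrow> bool" where
  "pos_def M \<longleftrightarrow> sym_mat M \<and> (\<forall>x. x \<noteq> 0 \<longrightarrow> x \<bullet> (M *v x) > 0)"

definition param_seqs :: "(real^'p) set \<Rightarrow> (nat \<Rightarrow> real^'p) set" where
  "param_seqs PP = {p. \<forall>k. p k \<in> PP}"

definition poly_comb ::
  "nat \<Rightarrow> (nat \<Rightarrow> real^'p \<Rightarrow> real) \<Rightarrow> (nat \<Rightarrow> real^'n^'m) \<Rightarrow> real^'p \<Rightarrow> real^'n^'m" where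
  "poly_comb N \<xi> M \<pi> = (\<Sum>i\<in>{1..N}. \<xi> i \<pi> *\<^sub>R M i)"

definition polytopic ::
  "(real^'p) set \<Rightarrow> (real^'p \<Rightarrow> real^'n^'n) \<Rightarrow> nat \<Rightarrow> (nat \<Rightarrow> real^'p \<Rightarrow> real)
    \<Rightarrow> (nat \<Rightarrow> real^'n^'n) \<Rightarrow> bool" where
  "polytopic PP A N \<xi> Av \<longleftrightarrow>
     (\<forall>i\<in>{1..N}. continuous_on PP (\<xi> i)) \<and>
     (\<forall>i\<in>{1..N}. \<forall>\<pi>\<in>PP. \<xi> i \<pi> \<ge> 0) \<and>
     (\<forall>\<pi>\<in>PP. (\<Sum>i\<in>{1..N}. \<xi> i \<pi>) = 1) \<and>
     (\<forall>\<pi>\<in>PP. A \<pi> = poly_comb N \<xi> Av \<pi>)"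

definition quad_fun :: "(real^'p \<Rightarrow> real^'n^'n) \<Rightarrow> real^'p \<Rightarrow> real^'n \<Rightarrow> real" where
  "quad_fun P \<pi> x = x \<bullet> (P \<pi> *v x)"

(* The coefficients Pb i are only required to be symmetric.  The bounds make
   poly_comb N \<xi> Pb \<pi> positive definite for \<pi> in PP, but not each Pb i, unless every
   weight \<xi> i attains the value 1 on PP. *)
definition poly_QLF ::
  "(real^'p) set \<Rightarrow> nat \<Rightarrow> (nat \<Rightarrow> real^'p \<Rightarrow> real) \<Rightarrow> (nat \<Rightarrow> real^'n^'n)
    \<Rightarrow> (nat \<Rightarrow> (nat \<Rightarrow> real^'p) \<Rightarrow> real^'n^'n) \<Rightarrow> bool" where
  "poly_QLF PP N \<xi> Pb F \<longleftrightarrow>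
     (\<forall>i\<in>{1..N}. sym_mat (Pb i)) \<and>
     (\<exists>a1>0. \<exists>a2>0. \<exists>a3>0.
        (\<forall>\<pi>\<in>PP. \<forall>x. a1 * (norm x)\<^sup>2 \<le> quad_fun (poly_comb N \<xi> Pb) \<pi> x \<and>
                      quad_fun (poly_comb N \<xi> Pb) \<pi> x \<le> a2 * (norm x)\<^sup>2) \<and>
        (\<forall>k. \<forall>p\<in>param_seqs PP. \<forall>x.
           quad_fun (poly_comb N \<xi> Pb) (p (Suc k)) (F k p *v x)
             \<le> quad_fun (poly_comb N \<xi> Pb) (p k) x - a3 * (norm x)\<^sup>2))"

definition poly_QS ::
  "(real^'p) set \<Rightarrow> nat \<Rightarrow> (nat \<Rightarrow> real^'p \<Rightarrow> real)
    \<Rightarrow> (nat \<Rightarrow> (nat \<Rightarrow> real^'p) \<Rightarrow> real^'n^'n) \<Rightarrow> bool" where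
  "poly_QS PP N \<xi> F \<longleftrightarrow> (\<exists>Pb. poly_QLF PP N \<xi> Pb F)"

definition closed_loop ::
  "(real^'p \<Rightarrow> real^'n^'n) \<Rightarrow> real^'u^'n \<Rightarrow> (nat \<Rightarrow> (nat \<Rightarrow> real^'p) \<Rightarrow> real^'n^'u)
    \<Rightarrow> nat \<Rightarrow> (nat \<Rightarrow> real^'p) \<Rightarrow> real^'n^'n" where
  "closed_loop A B K k p = A (p k) + B ** K k p"

definition poly_Q_stabilizable ::
  "(real^'p) set \<Rightarrow> nat \<Rightarrow> (nat \<Rightarrow> real^'p \<Rightarrow> real)
    \<Rightarrow> (real^'p \<Rightarrow> real^'n^'n) \<Rightarrow> real^'u^'n \<Rightarrow> bool" where
  "poly_Q_stabilizable PP N \<xi> A B \<longleftrightarrow> (\<exists>K. poly_QS PP N \<xi> (closed_loop A B K))"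

definition P_of :: "nat \<Rightarrow> (nat \<Rightarrow> real^'p \<Rightarrow> real) \<Rightarrow> (nat \<Rightarrow> real^'n^'n) \<Rightarrow> real^'p \<Rightarrow> real^'n^'n" where
  "P_of N \<xi> Sb = poly_comb N \<xi> (\<lambda>i. matrix_inv (Sb i))"

definition S_of :: "nat \<Rightarrow> (nat \<Rightarrow> real^'p \<Rightarrow> real) \<Rightarrow> (nat \<Rightarrow> real^'n^'n) \<Rightarrow> real^'p \<Rightarrow> real^'n^'n" where
  "S_of N \<xi> Sb \<pi> = matrix_inv (P_of N \<xi> Sb \<pi>)"

definition stabilizability_cond ::
  "(real^'p) set \<Rightarrow> nat \<Rightarrow> (nat \<Rightarrow> real^'p \<Rightarrow> real)
    \<Rightarrow> (real^'p \<Rightarrow> real^'n^'n) \<Rightarrow> real^'u^'n \<Rightarrow> (nat \<Rightarrow> real^'n^'n) \<Rightarrow> bool" where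
  "stabilizability_cond PP N \<xi> A B Sb \<longleftrightarrow>
     (\<forall>i\<in>{1..N}. pos_def (Sb i)) \<and>
     (\<forall>\<pi>'\<in>PP. \<forall>\<pi>\<in>PP.
        pos_def (S_of N \<xi> Sb \<pi>' - A \<pi> ** S_of N \<xi> Sb \<pi> ** transpose (A \<pi>) + B ** transpose B))"

definition ctrl_gain ::
  "nat \<Rightarrow> (nat \<Rightarrow> real^'p \<Rightarrow> real) \<Rightarrow> (real^'p \<Rightarrow> real^'n^'n) \<Rightarrow> real^'u^'n \<Rightarrow> (nat \<Rightarrow> real^'n^'n)
    \<Rightarrow> nat \<Rightarrow> (nat \<Rightarrow> real^'p) \<Rightarrow> real^'n^'u" where
  "ctrl_gain N \<xi> A B Sb k p =
     - (transpose B ** matrix_inv (S_of N \<xi> Sb (p (Suc k)) + B ** transpose B) ** A (p k))"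

end

theory Submission
  imports Defs
begin

text \<open>Both directions rest on completing the square, 2 x y \<open>\<le>\<close> x P x + y S y with S the inverse of P,
  which replaces Schur complements. For the gain of the theorem the closed loop sends x to S' z, where
  (S' + B B\<open>\<^sup>T\<close>) z = A x, so its decrease reduces to z A S A\<open>\<^sup>T\<close> z < z (S' + B B\<open>\<^sup>T\<close>) z. Conversely, any
  stabilizing gain disappears on the kernel of B\<open>\<^sup>T\<close>. Compactness of the parameter set makes both
  arguments uniform.\<close>

section \<open>Transposes as adjoints, and linearity of matrix expressions\<close>

lemma inner_transpose_mult_vec:
  fixes M :: "real^'n^'m"
  shows "(transpose M *v x) \<bullet> y = x \<bullet> (M *v y)"
  unfolding transpose_matrix_vector by (rule dot_lmul_matrix)

lemma inner_mult_vec: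
  fixes M :: "real^'n^'m"
  shows "(M *v x) \<bullet> y = x \<bullet> (transpose M *v y)"
  using inner_transpose_mult_vec[of "transpose M" x y] by (simp only: transpose_transpose)

lemma inner_congruence:
  fixes M :: "real^'n^'m" and S :: "real^'n^'n"
  shows "x \<bullet> ((M ** S ** transpose M) *v x) = (transpose M *v x) \<bullet> (S *v (transpose M *v x))"
  unfolding matrix_vector_mul_assoc[symmetric] by (rule inner_transpose_mult_vec[symmetric])

lemma inner_mult_transpose:
  fixes M :: "real^'n^'m"
  shows "x \<bullet> ((M ** transpose M) *v x) = (transpose M *v x) \<bullet> (transpose M *v x)"
  unfolding matrix_vector_mul_assoc[symmetric] by (rule inner_transpose_mult_vec[symmetric])

lemma sym_mat_inner: "sym_mat M \<Longrightarrow> (M *v x) \<bullet> y = x \<bullet> (M *v y)"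
  using inner_mult_vec[of M x y] by (simp only: sym_mat_def)

lemma mult_vec_uminus:
  fixes M :: "real^'n^'m"
  shows "(- M) *v x = - (M *v x)"
  by (simp add: matrix_vector_mult_def vec_eq_iff sum_negf)

lemma transpose_add:
  fixes M M' :: "real^'n^'m"
  shows "transpose (M + M') = transpose M + transpose M'"
  by (simp add: transpose_def vec_eq_iff)

lemma transpose_diff:
  fixes M M' :: "real^'n^'m"
  shows "transpose (M - M') = transpose M - transpose M'"
  by (simp add: transpose_def vec_eq_iff)

lemma sym_mat_sum: "(\<And>i. i \<in> I \<Longrightarrow> sym_mat (f i)) \<Longrightarrow> sym_mat (\<Sum>i\<in>I. f i)"
  by (simp add: sym_mat_def transpose_def vec_eq_iff)

lemma sym_mat_scaleR: "sym_mat M \<Longrightarrow> sym_mat (c *\<^sub>R M)"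
  by (simp add: sym_mat_def transpose_scalar)

lemma sum_mult_vec:
  fixes M :: "'i \<Rightarrow> real^'n^'m"
  shows "(\<Sum>i\<in>I. M i) *v x = (\<Sum>i\<in>I. M i *v x)"
  by (induction I rule: infinite_finite_induct) (auto simp: matrix_vector_mult_add_rdistrib)

lemma inner_poly_comb:
  "x \<bullet> (poly_comb N \<xi> M \<pi> *v y) = (\<Sum>i\<in>{1..N}. \<xi> i \<pi> * (x \<bullet> (M i *v y)))"
  by (simp add: poly_comb_def sum_mult_vec inner_sum_right flip: scaleR_matrix_vector_assoc)

section \<open>Matrix inverses\<close>

lemma matrix_inv_works:
  assumes "invertible M"
  shows "M ** matrix_inv M = mat 1" "matrix_inv M ** M = mat 1"
  using someI_ex[OF assms[unfolded invertible_def]] by (auto simp: matrix_inv_def)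

lemma mult_vec_matrix_inv:
  fixes M :: "real^'n^'n"
  assumes "invertible M"
  shows "M *v (matrix_inv M *v x) = x" "matrix_inv M *v (M *v x) = x"
  using matrix_inv_works[OF assms] by (simp_all add: matrix_vector_mul_assoc)

text \<open>\<open>matrix_inv\<close> is a Hilbert choice among two-sided inverses; for a square
  matrix a right inverse already pins it down. Inverses can thus be computed by exhibiting a
  candidate.\<close>

lemma matrix_inv_unique:
  fixes M :: "real^'n^'n"
  assumes "M ** M' = mat 1"
  shows "matrix_inv M = M'"
proof -
  have "invertible M"
    using assms by (auto simp: invertible_right_inverse)
  then have "matrix_inv M ** (M ** M') = M'"
    by (simp add: matrix_mul_assoc matrix_inv_works)
  then show ?thesis by (simp add: assms)
qed

lemma matrix_inv_matrix_inv:
  fixes M :: "real^'n^'n"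
  shows "invertible M \<Longrightarrow> matrix_inv (matrix_inv M) = M"
  by (rule matrix_inv_unique) (rule matrix_inv_works)

lemma matrix_inv_scaleR:
  fixes M :: "real^'n^'n"
  assumes "invertible M" "c \<noteq> 0"
  shows "matrix_inv (c *\<^sub>R M) = inverse c *\<^sub>R matrix_inv M"
proof (rule matrix_inv_unique)
  show "c *\<^sub>R M ** inverse c *\<^sub>R matrix_inv M = mat 1"
    using assms by (simp add: matrix_scalar_ac matrix_inv_works)
qed

section \<open>Positive definite matrices\<close>

lemma pos_def_invertible:
  assumes "pos_def M"
  shows "invertible M"
proof -
  have "x = 0" if "M *v x = 0" for x
    using assms that by (metis inner_zero_right less_irrefl pos_def_def)
  then show ?thesis
    by (simp add: invertible_left_inverse matrix_left_invertible_ker)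
qed

text \<open>The substitution x = M y turns the quadratic form of the inverse at x into that of M at
  y. Symmetry holds because the transposed inverse is again a right inverse of M.\<close>

lemma pos_def_matrix_inv:
  assumes "pos_def M"
  shows "pos_def (matrix_inv M)"
proof -
  have inv: "invertible M" using assms by (rule pos_def_invertible)
  have "M ** transpose (matrix_inv M) = transpose (matrix_inv M ** M)"
    using assms by (simp add: matrix_transpose_mul pos_def_def sym_mat_def)
  also have "\<dots> = mat 1" using inv by (simp add: matrix_inv_works transpose_mat)
  finally have "sym_mat (matrix_inv M)"
    unfolding sym_mat_def by (rule matrix_inv_unique[symmetric])
  moreover have "x \<bullet> (matrix_inv M *v x) > 0" if "x \<noteq> 0" for x
  proof -
    let ?y = "matrix_inv M *v x"
    have x: "M *v ?y = x" using inv by (rule mult_vec_matrix_inv)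
    then have "?y \<noteq> 0" using that by auto
    then have "?y \<bullet> (M *v ?y) > 0" using assms by (auto simp: pos_def_def)
    then show ?thesis unfolding x by (simp add: inner_commute)
  qed
  ultimately show ?thesis by (simp add: pos_def_def)
qed

lemma pos_def_scaleR: "pos_def M \<Longrightarrow> c > 0 \<Longrightarrow> pos_def (c *\<^sub>R M)"
  by (simp add: pos_def_def sym_mat_scaleR flip: scaleR_matrix_vector_assoc)

lemma pos_def_nonneg: "pos_def M \<Longrightarrow> x \<bullet> (M *v x) \<ge> 0"
  by (cases "x = 0") (auto simp: pos_def_def less_imp_le)

text \<open>Nonnegative weights with sum 1 cannot all vanish, so one summand of the quadratic form
  is strictly positive and the others are nonnegative.\<close>

lemma pos_def_poly_comb:
  assumes "\<And>i. i \<in> {1..N} \<Longrightarrow> pos_def (M i)"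
    and "\<And>i. i \<in> {1..N} \<Longrightarrow> \<xi> i \<pi> \<ge> 0"
    and "(\<Sum>i\<in>{1..N}. \<xi> i \<pi>) = 1"
  shows "pos_def (poly_comb N \<xi> M \<pi>)"
  unfolding pos_def_def
proof (intro conjI allI impI)
  show "sym_mat (poly_comb N \<xi> M \<pi>)"
    using assms(1) by (auto simp: poly_comb_def pos_def_def intro!: sym_mat_sum sym_mat_scaleR)
next
  fix x :: "real^'a" assume "x \<noteq> 0"
  have "\<exists>i\<in>{1..N}. \<xi> i \<pi> \<noteq> 0"
    using assms(3) by (metis sum.neutral zero_neq_one)
  then obtain i where "i \<in> {1..N}" "\<xi> i \<pi> > 0"
    using assms(2) by (metis order_le_less)
  moreover have "x \<bullet> (M j *v x) > 0" if "j \<in> {1..N}" for j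
    using assms(1) that \<open>x \<noteq> 0\<close> by (auto simp: pos_def_def)
  ultimately show "0 < x \<bullet> (poly_comb N \<xi> M \<pi> *v x)"
    unfolding inner_poly_comb using assms(2)
    by (intro sum_pos2[where i = i]) (auto intro!: mult_nonneg_nonneg simp: less_imp_le)
qed

lemma pos_def_add_mult_transpose:
  assumes "pos_def S"
  shows "pos_def (S + B ** transpose B)"
  unfolding pos_def_def
proof (intro conjI allI impI)
  show "sym_mat (S + B ** transpose B)"
    using assms by (simp add: pos_def_def sym_mat_def transpose_add matrix_transpose_mul)
  show "0 < u \<bullet> ((S + B ** transpose B) *v u)" if "u \<noteq> 0" for u
    using assms that by (simp add: pos_def_def matrix_vector_mult_add_rdistrib inner_add_right
        inner_mult_transpose add_pos_nonneg)
qed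

subsection \<open>Continuity\<close>

lemma continuous_on_mult_vec:
  fixes f :: "'a::topological_space \<Rightarrow> real^'n^'m"
  assumes "continuous_on S f" "continuous_on S g"
  shows "continuous_on S (\<lambda>x. f x *v g x)"
  unfolding matrix_vector_mult_def
  by (intro continuous_on_vec_lambda continuous_intros assms
      continuous_on_component[OF continuous_on_component] continuous_on_component)

lemma continuous_on_matrix_mult:
  fixes f :: "'a::topological_space \<Rightarrow> real^'n^'m" and g :: "'a \<Rightarrow> real^'k^'n"
  assumes "continuous_on S f" "continuous_on S g"
  shows "continuous_on S (\<lambda>x. f x ** g x)"
  unfolding matrix_matrix_mult_def
  by (intro continuous_on_vec_lambda continuous_intros assms
      continuous_on_component[OF continuous_on_component])

lemma continuous_on_transpose:
  fixes f :: "'a::topological_space \<Rightarrow> real^'n^'m"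
  assumes "continuous_on S f"
  shows "continuous_on S (\<lambda>x. transpose (f x))"
  unfolding transpose_def
  by (intro continuous_on_vec_lambda continuous_on_component assms)

text \<open>The determinant is a polynomial in the entries. Continuity is assumed entrywise so that
  the lemma applies directly to matrices with a replaced column.\<close>

lemma continuous_on_det:
  fixes f :: "'a::topological_space \<Rightarrow> real^'n^'n"
  assumes "\<And>i j. continuous_on S (\<lambda>x. f x $ i $ j)"
  shows "continuous_on S (\<lambda>x. det (f x))"
  unfolding det_def by (intro continuous_intros assms)

text \<open>Cramer's rule expresses the entries of the inverse as quotients of determinants.\<close>

lemma continuous_on_matrix_inv:
  fixes f :: "'a::topological_space \<Rightarrow> real^'n^'n"
  assumes cont: "continuous_on S f" and inv: "\<And>x. x \<in> S \<Longrightarrow> invertible (f x)"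
  shows "continuous_on S (\<lambda>x. matrix_inv (f x))"
proof -
  \<comment> \<open>The numerator in Cramer's rule for the system
    \<open>f x *v v = axis j 1\<close>, whose solution is column \<open>j\<close> of the inverse:
    column \<open>i\<close> of \<open>f x\<close> is replaced by the right-hand side.\<close>
  let ?D = "\<lambda>x i j. det (\<chi> r c. if c = i then axis j 1 $ r else f x $ r $ c)"
  have entry: "matrix_inv (f x) $ i $ j = ?D x i j / det (f x)" if "x \<in> S" for x i j
  proof -
    have "f x *v (matrix_inv (f x) *v axis j 1) = axis j 1"
      using inv[OF that] by (rule mult_vec_matrix_inv)
    then have "(matrix_inv (f x) *v axis j 1) $ i = ?D x i j / det (f x)"
      by (subst (asm) cramer) (use inv[OF that] in \<open>simp_all add: invertible_det_nz\<close>)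
    then show ?thesis by (simp add: matrix_vector_mul_component inner_axis)
  qed
  have f: "continuous_on S (\<lambda>x. f x $ i $ j)" for i j
    by (intro continuous_on_component cont)
  have "continuous_on S (\<lambda>x. if c = i then axis j 1 $ r else f x $ r $ c)" for i j r c
    by (cases "c = i") (auto intro: f)
  then have "continuous_on S (\<lambda>x. ?D x i j / det (f x))" for i j
    using inv by (intro continuous_on_divide continuous_on_det f)
      (auto simp: invertible_det_nz)
  then have "continuous_on S (\<lambda>x. matrix_inv (f x) $ i $ j)" for i j
    using entry by (simp cong: continuous_on_cong)
  then have "continuous_on S (\<lambda>x. \<chi> i j. matrix_inv (f x) $ i $ j)"
    by (intro continuous_on_vec_lambda)
  then show ?thesis by simp
qed

lemma continuous_on_poly_comb:
  assumes "\<And>i. i \<in> {1..N} \<Longrightarrow> continuous_on S (\<xi> i)"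
  shows "continuous_on S (poly_comb N \<xi> M)"
proof -
  have "continuous_on S (\<lambda>\<pi>. \<Sum>i\<in>{1..N}. \<xi> i \<pi> *\<^sub>R M i)"
    by (intro continuous_intros assms)
  then show ?thesis by (simp add: poly_comb_def[abs_def])
qed

subsection \<open>Uniform estimates on compact sets\<close>

text \<open>The scalar core of Finsler's lemma: \<open>f\<close> can fail to be positive only where
  \<open>g\<close> is positive, and compactness lets one multiple of \<open>g\<close> compensate
  everywhere.\<close>

lemma compact_penalty:
  fixes f g :: "'a::topological_space \<Rightarrow> real"
  assumes "compact K" "continuous_on K f" "continuous_on K g"
    and nonneg: "\<And>x. x \<in> K \<Longrightarrow> g x \<ge> 0"
    and pos: "\<And>x. x \<in> K \<Longrightarrow> g x = 0 \<Longrightarrow> f x > 0"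
  shows "\<exists>\<mu>>0. \<forall>x\<in>K. f x + \<mu> * g x > 0"
proof (cases "K = {}")
  case True
  then show ?thesis by (auto intro: exI[of _ 1])
next
  case False
  \<comment> \<open>\<open>max f g\<close> is positive everywhere on \<open>K\<close>, hence bounded away from 0.\<close>
  obtain y where y: "y \<in> K" "\<And>x. x \<in> K \<Longrightarrow> max (f y) (g y) \<le> max (f x) (g x)"
    using continuous_attains_inf[OF assms(1) False, of "\<lambda>x. max (f x) (g x)"]
      continuous_on_max[OF assms(2,3)] by auto
  obtain z where z: "z \<in> K" "\<And>x. x \<in> K \<Longrightarrow> f z \<le> f x"
    using continuous_attains_inf[OF assms(1) False assms(2)] by auto
  define \<delta> where "\<delta> = max (f y) (g y)"
  have \<delta>: "\<delta> > 0"
    using nonneg[OF y(1)] pos[OF y(1)] by (cases "g y = 0") (auto simp: \<delta>_def)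
  \<comment> \<open>Where \<open>f\<close> is not positive, \<open>g\<close> is at least \<delta>,
    so the penalty is at least \<open>\<bar>f z\<bar> + 1\<close> and outweighs the minimum
    \<open>f z\<close>. The summand 1 makes the inequality strict and \<mu> positive even if
    \<open>f z = 0\<close>.\<close>
  define \<mu> where "\<mu> = (\<bar>f z\<bar> + 1) / \<delta>"
  have "\<mu> > 0" using \<delta> by (simp add: \<mu>_def)
  moreover have "f x + \<mu> * g x > 0" if "x \<in> K" for x
  proof (cases "f x > 0")
    case True
    then show ?thesis using nonneg[OF that] \<open>\<mu> > 0\<close> by (simp add: add_pos_nonneg)
  next
    case False
    then have "g x \<ge> \<delta>" using y(2)[OF that] \<delta> by (auto simp: \<delta>_def max_def split: if_splits)
    then have "\<mu> * \<delta> \<le> \<mu> * g x" using \<open>\<mu> > 0\<close> by simp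
    moreover have "\<mu> * \<delta> = \<bar>f z\<bar> + 1" using \<delta> by (simp add: \<mu>_def)
    ultimately show ?thesis using z(2)[OF that] by linarith
  qed
  ultimately show ?thesis by blast
qed

text \<open>Both quadratic forms scale with \<open>(norm x)\<^sup>2\<close>, so it suffices to treat
  unit vectors, and the product of \<open>C\<close> with the unit sphere is compact.\<close>

lemma compact_quadratic_penalty:
  fixes Q R :: "'a::topological_space \<Rightarrow> real^'n^'n"
  assumes "compact C" "continuous_on C Q" "continuous_on C R"
    and nonneg: "\<And>c x. c \<in> C \<Longrightarrow> x \<bullet> (R c *v x) \<ge> 0"
    and pos: "\<And>c x. c \<in> C \<Longrightarrow> x \<noteq> 0 \<Longrightarrow> x \<bullet> (R c *v x) = 0 \<Longrightarrow> x \<bullet> (Q c *v x) > 0"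
  shows "\<exists>\<mu>>0. \<forall>c\<in>C. \<forall>x. x \<noteq> 0 \<longrightarrow> x \<bullet> (Q c *v x) + \<mu> * (x \<bullet> (R c *v x)) > 0"
proof -
  let ?K = "C \<times> sphere (0::real^'n) 1"
  have cont: "continuous_on ?K (\<lambda>z. snd z \<bullet> (G (fst z) *v snd z))"
    if "continuous_on C G" for G :: "'a \<Rightarrow> real^'n^'n"
  proof -
    have "continuous_on ?K (\<lambda>z. G (fst z))"
      by (rule continuous_on_compose2[OF that continuous_on_fst[OF continuous_on_id]]) auto
    then show ?thesis
      by (intro continuous_on_inner continuous_on_mult_vec continuous_intros)
  qed
  have "\<exists>\<mu>>0. \<forall>z\<in>?K. snd z \<bullet> (Q (fst z) *v snd z) + \<mu> * (snd z \<bullet> (R (fst z) *v snd z)) > 0"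
  proof (rule compact_penalty)
    show "compact ?K" using assms(1) by (intro compact_Times compact_sphere)
    show "snd z \<bullet> (Q (fst z) *v snd z) > 0"
      if "z \<in> ?K" "snd z \<bullet> (R (fst z) *v snd z) = 0" for z
      using pos[of "fst z" "snd z"] that by fastforce
  qed (use assms in \<open>auto intro!: cont\<close>)
  then obtain \<mu> where \<mu>: "\<mu> > 0"
    and sph: "\<And>c u. c \<in> C \<Longrightarrow> norm u = 1 \<Longrightarrow> u \<bullet> (Q c *v u) + \<mu> * (u \<bullet> (R c *v u)) > 0"
    by fastforce
  have "x \<bullet> (Q c *v x) + \<mu> * (x \<bullet> (R c *v x)) > 0" if "c \<in> C" "x \<noteq> 0" for c x
  proof -
    define u where "u = x /\<^sub>R norm x"
    have x: "x = norm x *\<^sub>R u" and u: "norm u = 1" using that by (auto simp: u_def)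
    have hom: "x \<bullet> (M *v x) = (norm x)\<^sup>2 * (u \<bullet> (M *v u))" for M :: "real^'n^'n"
      by (subst (1 2) x) (simp add: matrix_vector_mult_scaleR power2_eq_square)
    have "x \<bullet> (Q c *v x) + \<mu> * (x \<bullet> (R c *v x))
        = (norm x)\<^sup>2 * (u \<bullet> (Q c *v u) + \<mu> * (u \<bullet> (R c *v u)))"
      by (simp add: hom algebra_simps)
    then show ?thesis using sph[OF that(1) u] that(2) by simp
  qed
  with \<mu> show ?thesis by blast
qed

text \<open>The penalty lemma with \<open>- Q\<close> and the identity as penalty: the penalty
  vanishes only at 0, so the positivity condition on its zero set is vacuous.\<close>

lemma compact_quadratic_upper_bound:
  fixes Q :: "'a::topological_space \<Rightarrow> real^'n^'n"
  assumes "compact C" "continuous_on C Q"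
  shows "\<exists>a>0. \<forall>c\<in>C. \<forall>x. x \<bullet> (Q c *v x) \<le> a * (norm x)\<^sup>2"
proof -
  have "continuous_on C (\<lambda>c. - Q c)" using assms(2) by (intro continuous_intros)
  then obtain a where a: "a > 0"
    "\<And>c x. c \<in> C \<Longrightarrow> x \<noteq> 0 \<Longrightarrow> x \<bullet> ((- Q c) *v x) + a * (x \<bullet> (mat 1 *v x)) > 0"
    using compact_quadratic_penalty[OF assms(1), of "\<lambda>c. - Q c" "\<lambda>_. mat 1"] by auto
  have "x \<bullet> (Q c *v x) \<le> a * (norm x)\<^sup>2" if "c \<in> C" for c x
    using a(2)[OF that, of x]
    by (cases "x = 0") (auto simp: mult_vec_uminus power2_norm_eq_inner)
  with a(1) show ?thesis by blast
qed

text \<open>The roles are now exchanged: \<open>Q\<close> is the penalty and the negative identity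
  is the form to be compensated. The resulting factor \<mu> yields the lower bound
  \<open>inverse \<mu>\<close>.\<close>

lemma compact_quadratic_lower_bound:
  fixes Q :: "'a::topological_space \<Rightarrow> real^'n^'n"
  assumes "compact C" "continuous_on C Q"
    and "\<And>c x. c \<in> C \<Longrightarrow> x \<noteq> 0 \<Longrightarrow> x \<bullet> (Q c *v x) > 0"
  shows "\<exists>a>0. \<forall>c\<in>C. \<forall>x. a * (norm x)\<^sup>2 \<le> x \<bullet> (Q c *v x)"
proof -
  have R: "x \<bullet> (Q c *v x) \<ge> 0" if "c \<in> C" for c x
  proof (cases "x = 0")
    case False
    with assms(3) that show ?thesis by (intro less_imp_le)
  qed simp
  have "\<exists>\<mu>>0. \<forall>c\<in>C. \<forall>x. x \<noteq> 0 \<longrightarrow>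
      x \<bullet> ((- mat 1 :: real^'n^'n) *v x) + \<mu> * (x \<bullet> (Q c *v x)) > 0"
    using compact_quadratic_penalty[where Q = "\<lambda>_. - mat 1" and R = Q,
        OF assms(1) continuous_on_const assms(2) R] assms(3)
    by (metis less_irrefl)
  then obtain \<mu> where \<mu>: "\<mu> > 0" "\<And>c x. c \<in> C \<Longrightarrow> x \<noteq> 0 \<Longrightarrow>
      x \<bullet> ((- mat 1 :: real^'n^'n) *v x) + \<mu> * (x \<bullet> (Q c *v x)) > 0"
    by blast
  have "inverse \<mu> * (norm x)\<^sup>2 \<le> x \<bullet> (Q c *v x)" if "c \<in> C" for c x
  proof (cases "x = 0")
    case False
    then have "(norm x)\<^sup>2 < \<mu> * (x \<bullet> (Q c *v x))"
      using \<mu>(2)[OF that False] by (simp add: mult_vec_uminus power2_norm_eq_inner)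
    then show ?thesis using \<mu>(1) by (simp add: field_simps)
  qed simp
  moreover have "inverse \<mu> > 0" using \<mu>(1) by simp
  ultimately show ?thesis by blast
qed

subsection \<open>Pointwise Lyapunov inequalities\<close>

text \<open>Expansion of the nonnegative form of \<open>M\<close> at
  \<open>x - matrix_inv M *v y\<close>.\<close>

lemma inner_completion:
  assumes "pos_def M"
  shows "2 * (x \<bullet> y) \<le> x \<bullet> (M *v x) + y \<bullet> (matrix_inv M *v y)"
proof -
  have inv: "invertible M" and sym: "sym_mat M"
    using assms pos_def_invertible by (auto simp: pos_def_def)
  let ?y = "matrix_inv M *v y"
  have y: "M *v ?y = y" using inv by (rule mult_vec_matrix_inv)
  have "0 \<le> (x - ?y) \<bullet> (M *v (x - ?y))" using assms by (rule pos_def_nonneg)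
  also have "\<dots> = x \<bullet> (M *v x) - x \<bullet> y - ?y \<bullet> (M *v x) + ?y \<bullet> y"
    by (simp add: matrix_vector_mult_diff_distrib y inner_diff_left inner_diff_right)
  also have "?y \<bullet> (M *v x) = x \<bullet> y"
    using sym_mat_inner[OF sym, of ?y x] y by (simp add: inner_commute)
  finally show ?thesis by (simp add: inner_commute)
qed

text \<open>With M z = A x and w = A^T z, the inner product of x and w is z M z. Completing the
  square bounds 2 z M z by x P x + w P^(-1) w, and the condition makes the last term smaller than z
  M z. Hence z M z < x P x, while the left side of the claim is at most z M z.\<close>

lemma gain_decreases:
  fixes A P P' :: "real^'n^'n" and B :: "real^'u^'n"
  assumes P: "pos_def P" and P': "pos_def P'"
    and cond: "pos_def (matrix_inv P' - A ** matrix_inv P ** transpose A + B ** transpose B)"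
    and M: "M = matrix_inv P' + B ** transpose B"
    and F: "F = A + B ** (- (transpose B ** matrix_inv M ** A))"
    and "x \<noteq> 0"
  shows "(F *v x) \<bullet> (P' *v (F *v x)) < x \<bullet> (P *v x)"
proof -
  define z where "z = matrix_inv M *v (A *v x)"
  define w where "w = transpose A *v z"
  have BB: "u \<bullet> ((B ** transpose B) *v u) \<ge> 0" for u :: "real^'n"
    by (simp only: inner_mult_transpose inner_ge_zero)
  have "pos_def M"
    unfolding M using P' by (intro pos_def_add_mult_transpose pos_def_matrix_inv)
  then have Mz: "M *v z = A *v x"
    unfolding z_def by (intro mult_vec_matrix_inv pos_def_invertible)
  have "F *v x = A *v x - B *v (transpose B *v z)"
    by (simp add: F z_def matrix_vector_mult_add_rdistrib mult_vec_uminus vec.neg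
        flip: matrix_vector_mul_assoc)
  \<comment> \<open>Replacing A x by M z, the term in B B^T cancels against the feedback and only
    the inverse of \<open>P'\<close> remains.\<close>
  also have "\<dots> = matrix_inv P' *v z"
    by (simp add: M matrix_vector_mult_add_rdistrib matrix_vector_mul_assoc
        del: transpose_matrix_vector flip: Mz)
  finally have Fx: "F *v x = matrix_inv P' *v z" .
  have "(F *v x) \<bullet> (P' *v (F *v x)) = (matrix_inv P' *v z) \<bullet> z"
    using P' by (simp add: Fx mult_vec_matrix_inv pos_def_invertible)
  also have "\<dots> \<le> z \<bullet> (M *v z)"
    using BB[of z] by (simp add: M matrix_vector_mult_add_rdistrib inner_add_right inner_commute)
  finally have le: "(F *v x) \<bullet> (P' *v (F *v x)) \<le> z \<bullet> (M *v z)" .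
  \<comment> \<open>The condition is strict only for nonzero \<open>z\<close>; for
    \<open>z = 0\<close> strictness comes from the definiteness of \<open>P\<close> at
    \<open>x\<close>.\<close>
  show ?thesis
  proof (cases "z = 0")
    case True
    then show ?thesis using le P \<open>x \<noteq> 0\<close> by (auto simp: pos_def_def)
  next
    case False
    have "z \<bullet> ((A ** matrix_inv P ** transpose A) *v z) = w \<bullet> (matrix_inv P *v w)"
      unfolding w_def by (rule inner_congruence)
    moreover have "0 < z \<bullet> ((M - A ** matrix_inv P ** transpose A) *v z)"
      using cond False by (simp add: pos_def_def M algebra_simps)
    ultimately have "w \<bullet> (matrix_inv P *v w) < z \<bullet> (M *v z)"
      by (simp add: matrix_vector_mult_diff_rdistrib inner_diff_right)
    moreover have "x \<bullet> w = z \<bullet> (M *v z)"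
      by (simp add: w_def Mz inner_commute[of x] inner_transpose_mult_vec del: transpose_matrix_vector)
    moreover note inner_completion[OF P, of x w]
    ultimately show ?thesis using le by linarith
  qed
qed

text \<open>The decrease is tested at y = P^(-1) A^T x. For F = A + B K, completing the square gives
  2 (F y) x <= (F y) P' (F y) + x P'^(-1) x, and the decrease bounds the first term on the right by
  y P y. Both (F y) x and y P y equal x A P^(-1) A^T x.\<close>

lemma decrease_imp_inverse_condition:
  fixes A P P' :: "real^'n^'n" and B :: "real^'u^'n"
  assumes P: "pos_def P" and P': "pos_def P'"
    and dec: "\<And>y. y \<noteq> 0 \<Longrightarrow> ((A + B ** K) *v y) \<bullet> (P' *v ((A + B ** K) *v y)) < y \<bullet> (P *v y)"
    and Bx: "transpose B *v x = 0" and "x \<noteq> 0"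
  shows "0 < x \<bullet> ((matrix_inv P' - A ** matrix_inv P ** transpose A) *v x)"
proof -
  let ?F = "A + B ** K"
  define w where "w = transpose A *v x"
  define y where "y = matrix_inv P *v w"
  have S': "pos_def (matrix_inv P')" using P' by (rule pos_def_matrix_inv)
  have Py: "P *v y = w"
    using P by (simp add: y_def mult_vec_matrix_inv pos_def_invertible)
  have s: "x \<bullet> ((A ** matrix_inv P ** transpose A) *v x) = y \<bullet> w"
    unfolding w_def y_def inner_congruence by (rule inner_commute)
  \<comment> \<open>The contribution of \<open>K\<close> is K^T B^T x, which is zero; this is how an
    arbitrary gain drops out.\<close>
  have "w = transpose ?F *v x"
    using Bx by (simp add: w_def transpose_add matrix_transpose_mul
        matrix_vector_mult_add_rdistrib flip: matrix_vector_mul_assoc)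
  then have wF: "y \<bullet> w = (?F *v y) \<bullet> x"
    by (simp only: inner_mult_vec)
  have "y \<bullet> w < x \<bullet> (matrix_inv P' *v x)"
  proof (cases "y = 0")
    case True
    then show ?thesis using S' \<open>x \<noteq> 0\<close> by (simp add: pos_def_def)
  next
    case False
    then show ?thesis
      using dec[of y] inner_completion[OF P', of "?F *v y" x] Py wF by simp
  qed
  then show ?thesis
    by (simp add: s matrix_vector_mult_diff_rdistrib inner_diff_right)
qed

subsection \<open>Polytopic systems\<close>

lemma polytopic_pos_def:
  assumes "polytopic PP A N \<xi> Av" "\<forall>i\<in>{1..N}. pos_def (M i)" "\<pi> \<in> PP"
  shows "pos_def (poly_comb N \<xi> M \<pi>)"
  using assms by (intro pos_def_poly_comb) (auto simp: polytopic_def)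

lemma polytopic_continuous_poly_comb:
  "polytopic PP A N \<xi> Av \<Longrightarrow> continuous_on PP (poly_comb N \<xi> M)"
  by (rule continuous_on_poly_comb) (simp add: polytopic_def)

lemma polytopic_continuous:
  assumes "polytopic PP A N \<xi> Av"
  shows "continuous_on PP A"
proof -
  have "continuous_on PP (poly_comb N \<xi> Av)"
    using assms by (rule polytopic_continuous_poly_comb)
  then show ?thesis
    using assms by (simp add: polytopic_def cong: continuous_on_cong)
qed

lemma continuous_on_pair_fst:
  "continuous_on X f \<Longrightarrow> continuous_on (X \<times> Y) (\<lambda>z. f (fst z))"
  by (rule continuous_on_compose2[OF _ continuous_on_fst[OF continuous_on_id]]) auto

lemma continuous_on_pair_snd:
  "continuous_on Y f \<Longrightarrow> continuous_on (X \<times> Y) (\<lambda>z. f (snd z))"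
  by (rule continuous_on_compose2[OF _ continuous_on_snd[OF continuous_on_id]]) auto

text \<open>The closed loop depends on time and on the sequence only through two consecutive
  parameters, continuously. The strict pointwise decrease on the compact set of such pairs therefore
  has a uniform margin.\<close>

lemma poly_QLF_ctrl_gain:
  assumes PP: "compact PP" and poly: "polytopic PP A N \<xi> Av"
    and cond: "stabilizability_cond PP N \<xi> A B Sb"
  shows "poly_QLF PP N \<xi> (\<lambda>i. matrix_inv (Sb i)) (closed_loop A B (ctrl_gain N \<xi> A B Sb))"
proof -
  define P where "P = P_of N \<xi> Sb"
  define S where "S = (\<lambda>\<pi>. matrix_inv (P \<pi>))"
  define M where "M = (\<lambda>\<pi>. S \<pi> + B ** transpose B)"
  \<comment> \<open>Here and below a pair \<open>z\<close> holds the successor parameter in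
    \<open>fst z\<close> and the current one in \<open>snd z\<close>.\<close>
  define F where "F = (\<lambda>z. A (snd z) + B ** (- (transpose B ** matrix_inv (M (fst z)) ** A (snd z))))"
  have S_of: "S_of N \<xi> Sb = S"
    by (simp add: S_def P_def S_of_def fun_eq_iff)
  have vertex: "\<forall>i\<in>{1..N}. pos_def (matrix_inv (Sb i))"
    using cond by (simp add: stabilizability_cond_def pos_def_matrix_inv)
  have P: "pos_def (P \<pi>)" if "\<pi> \<in> PP" for \<pi>
    unfolding P_def P_of_def using poly vertex that by (rule polytopic_pos_def)
  have M: "pos_def (M \<pi>)" if "\<pi> \<in> PP" for \<pi>
    unfolding M_def S_def using P[OF that]
    by (intro pos_def_add_mult_transpose pos_def_matrix_inv)
  have contP: "continuous_on PP P"
    unfolding P_def P_of_def using poly by (rule polytopic_continuous_poly_comb)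
  have contM: "continuous_on PP M"
    unfolding M_def S_def
    by (intro continuous_intros continuous_on_matrix_inv contP pos_def_invertible P)
  have contMinv: "continuous_on PP (\<lambda>\<pi>. matrix_inv (M \<pi>))"
    by (intro continuous_on_matrix_inv contM pos_def_invertible M)
  have contA: "continuous_on PP A"
    using poly by (rule polytopic_continuous)
  have contF: "continuous_on (PP \<times> PP) F"
    unfolding F_def
    by (intro continuous_on_add continuous_on_minus continuous_on_matrix_mult continuous_on_const
        continuous_on_pair_fst[OF contMinv] continuous_on_pair_snd[OF contA])
  \<comment> \<open>The quadratic form of \<open>D z\<close> is the one-step decrease of the
    Lyapunov function; its uniform lower bound supplies \<open>a3\<close>.\<close>
  define D where "D = (\<lambda>z. P (snd z) - transpose (F z) ** P (fst z) ** F z)"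
  have contD: "continuous_on (PP \<times> PP) D"
    unfolding D_def
    by (intro continuous_on_diff continuous_on_matrix_mult continuous_on_transpose contF
        continuous_on_pair_fst[OF contP] continuous_on_pair_snd[OF contP])
  have D: "x \<bullet> (D z *v x) = x \<bullet> (P (snd z) *v x) - (F z *v x) \<bullet> (P (fst z) *v (F z *v x))" for x z
    using inner_congruence[of x "transpose (F z)" "P (fst z)"]
    by (simp add: D_def matrix_vector_mult_diff_rdistrib inner_diff_right)
  have "0 < x \<bullet> (D z *v x)" if "z \<in> PP \<times> PP" "x \<noteq> 0" for z x
  proof -
    have "pos_def (matrix_inv (P (fst z)) - A (snd z) ** matrix_inv (P (snd z)) ** transpose (A (snd z))
        + B ** transpose B)"
      using cond that(1) unfolding stabilizability_cond_def S_of S_def by auto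
    then have "(F z *v x) \<bullet> (P (fst z) *v (F z *v x)) < x \<bullet> (P (snd z) *v x)"
      using P that by (intro gain_decreases) (auto simp: F_def M_def S_def)
    then show ?thesis by (simp add: D)
  qed
  then obtain a3 where a3: "a3 > 0"
    "\<And>z x. z \<in> PP \<times> PP \<Longrightarrow> a3 * (norm x)\<^sup>2 \<le> x \<bullet> (D z *v x)"
    using compact_quadratic_lower_bound[OF compact_Times[OF PP PP] contD] by blast
  obtain a1 where a1: "a1 > 0" "\<And>\<pi> x. \<pi> \<in> PP \<Longrightarrow> a1 * (norm x)\<^sup>2 \<le> x \<bullet> (P \<pi> *v x)"
    using compact_quadratic_lower_bound[OF PP contP] P by (auto simp: pos_def_def)
  obtain a2 where a2: "a2 > 0" "\<And>\<pi> x. \<pi> \<in> PP \<Longrightarrow> x \<bullet> (P \<pi> *v x) \<le> a2 * (norm x)\<^sup>2"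
    using compact_quadratic_upper_bound[OF PP contP] by auto
  have quad: "quad_fun (poly_comb N \<xi> (\<lambda>i. matrix_inv (Sb i))) \<pi> x = x \<bullet> (P \<pi> *v x)" for \<pi> x
    by (simp add: quad_fun_def P_def P_of_def)
  have loop: "closed_loop A B (ctrl_gain N \<xi> A B Sb) k p = F (p (Suc k), p k)" for k p
    by (simp add: closed_loop_def ctrl_gain_def S_of F_def M_def)
  have "(F (p (Suc k), p k) *v x) \<bullet> (P (p (Suc k)) *v (F (p (Suc k), p k) *v x))
      \<le> x \<bullet> (P (p k) *v x) - a3 * (norm x)\<^sup>2"
    if "p \<in> param_seqs PP" for k p x
    using a3(2)[of "(p (Suc k), p k)" x] that by (simp add: D param_seqs_def)
  then show ?thesis
    unfolding poly_QLF_def quad loop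
    using vertex a1 a2 a3(1)
    by (intro conjI exI[of _ a1] exI[of _ a2] exI[of _ a3]) (auto simp: pos_def_def)
qed

text \<open>A Finsler-type argument: on the kernel of the transpose of \<open>B\<close> the condition holds without the
  term in \<open>B\<close>, so by compactness one multiple \<open>\<mu>\<close> of that term works for all parameters, and \<open>\<mu>\<close> is
  absorbed by rescaling the Lyapunov function.\<close>

lemma poly_QLF_imp_stabilizability_cond:
  assumes PP: "compact PP" and poly: "polytopic PP A N \<xi> Av"
    and Pb: "\<forall>i\<in>{1..N}. pos_def (Pb i)"
    and QLF: "poly_QLF PP N \<xi> Pb (closed_loop A B K)"
  shows "\<exists>Sb. stabilizability_cond PP N \<xi> A B Sb"
proof -
  define P where "P = poly_comb N \<xi> Pb"
  define Q where "Q = (\<lambda>z. matrix_inv (P (fst z))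
      - A (snd z) ** matrix_inv (P (snd z)) ** transpose (A (snd z)))"
  have P: "pos_def (P \<pi>)" if "\<pi> \<in> PP" for \<pi>
    unfolding P_def using poly Pb that by (rule polytopic_pos_def)
  have contP: "continuous_on PP P"
    unfolding P_def using poly by (rule polytopic_continuous_poly_comb)
  have contS: "continuous_on PP (\<lambda>\<pi>. matrix_inv (P \<pi>))"
    by (intro continuous_on_matrix_inv contP pos_def_invertible P)
  have contA: "continuous_on PP A"
    using poly by (rule polytopic_continuous)
  have contQ: "continuous_on (PP \<times> PP) Q"
    unfolding Q_def
    by (intro continuous_on_diff continuous_on_matrix_mult continuous_on_transpose
        continuous_on_pair_fst[OF contS] continuous_on_pair_snd[OF contS]
        continuous_on_pair_snd[OF contA])
  obtain a3 where a3: "a3 > 0"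
    "\<And>k p x. p \<in> param_seqs PP \<Longrightarrow>
      quad_fun P (p (Suc k)) (closed_loop A B K k p *v x) \<le> quad_fun P (p k) x - a3 * (norm x)\<^sup>2"
    using QLF unfolding poly_QLF_def P_def by blast
  have BB: "x \<bullet> ((B ** transpose B) *v x) = (transpose B *v x) \<bullet> (transpose B *v x)" for x
    by (rule inner_mult_transpose)
  have "0 < x \<bullet> (Q z *v x)"
    if z: "z \<in> PP \<times> PP" and x: "x \<noteq> 0" "x \<bullet> ((B ** transpose B) *v x) = 0" for z x
  proof -
    \<comment> \<open>Every pair of parameters starts some admissible sequence, so the decrease at
      time 0 covers all pairs. The gain may look at the whole sequence, but only the single matrix
      \<open>K 0 p\<close> enters.\<close>
    define p where "p = (\<lambda>k::nat. if k = 0 then snd z else fst z)"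
    have p: "p \<in> param_seqs PP" using z by (auto simp: p_def param_seqs_def)
    have "((A (snd z) + B ** K 0 p) *v y) \<bullet> (P (fst z) *v ((A (snd z) + B ** K 0 p) *v y))
        < y \<bullet> (P (snd z) *v y)" if "y \<noteq> 0" for y
    proof -
      have "a3 * (norm y)\<^sup>2 > 0" using a3(1) that by simp
      then show ?thesis
        using a3(2)[OF p, of 0 y] by (simp add: quad_fun_def closed_loop_def p_def)
    qed
    then show ?thesis
      unfolding Q_def using P z x by (intro decrease_imp_inverse_condition) (auto simp: BB)
  qed
  \<comment> \<open>The penalty form of B B^T is the squared norm of B^T x, so its zero set is the
    kernel of B^T, where positivity of \<open>Q\<close> was just shown.\<close>
  then obtain \<mu> where \<mu>: "\<mu> > 0"
    "\<And>z x. z \<in> PP \<times> PP \<Longrightarrow> x \<noteq> 0 \<Longrightarrow>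
      x \<bullet> (Q z *v x) + \<mu> * (x \<bullet> ((B ** transpose B) *v x)) > 0"
    using compact_quadratic_penalty[OF compact_Times[OF PP PP] contQ, of "\<lambda>_. B ** transpose B"]
    by (auto simp: BB)
  \<comment> \<open>This scales P by \<mu> and S by 1/\<mu> but leaves B B^T alone, so the matrix of
    the condition becomes 1/\<mu> times Q + \<mu> B B^T.\<close>
  define Sb where "Sb = (\<lambda>i. inverse \<mu> *\<^sub>R matrix_inv (Pb i))"
  have Sb_inv: "matrix_inv (Sb i) = \<mu> *\<^sub>R Pb i" if "i \<in> {1..N}" for i
  proof -
    have "pos_def (Pb i)" using Pb that by auto
    then show ?thesis
      using \<mu>(1) by (simp add: Sb_def matrix_inv_scaleR matrix_inv_matrix_inv pos_def_matrix_inv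
          pos_def_invertible)
  qed
  have "P_of N \<xi> Sb \<pi> = \<mu> *\<^sub>R P \<pi>" for \<pi>
    by (simp add: P_of_def P_def poly_comb_def Sb_inv scaleR_sum_right mult.commute)
  then have S_of: "S_of N \<xi> Sb \<pi> = inverse \<mu> *\<^sub>R matrix_inv (P \<pi>)" if "\<pi> \<in> PP" for \<pi>
    using \<mu>(1) P[OF that] by (simp add: S_of_def matrix_inv_scaleR pos_def_invertible)
  have "pos_def (S_of N \<xi> Sb \<pi>' - A \<pi> ** S_of N \<xi> Sb \<pi> ** transpose (A \<pi>) + B ** transpose B)"
    if "\<pi>' \<in> PP" "\<pi> \<in> PP" for \<pi>' \<pi>
  proof -
    let ?R = "Q (\<pi>', \<pi>) + \<mu> *\<^sub>R (B ** transpose B)"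
    have "A \<pi> ** (inverse \<mu> *\<^sub>R matrix_inv (P \<pi>)) ** transpose (A \<pi>)
        = inverse \<mu> *\<^sub>R (A \<pi> ** matrix_inv (P \<pi>) ** transpose (A \<pi>))"
      by (simp add: matrix_scalar_ac scalar_matrix_assoc)
    then have eq: "S_of N \<xi> Sb \<pi>' - A \<pi> ** S_of N \<xi> Sb \<pi> ** transpose (A \<pi>) + B ** transpose B
        = inverse \<mu> *\<^sub>R ?R"
      using that \<mu>(1) by (simp add: S_of Q_def scaleR_right_diff_distrib scaleR_right_distrib)
    have "sym_mat (matrix_inv (P \<pi>'))" "sym_mat (matrix_inv (P \<pi>))"
      using pos_def_matrix_inv[OF P] that by (auto simp: pos_def_def)
    then have "sym_mat ?R"
      by (simp add: Q_def sym_mat_def transpose_add transpose_diff transpose_scalar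
          matrix_transpose_mul matrix_mul_assoc)
    moreover have "0 < x \<bullet> (?R *v x)" if "x \<noteq> 0" for x
      using \<mu>(2)[of "(\<pi>', \<pi>)" x] \<open>\<pi>' \<in> PP\<close> \<open>\<pi> \<in> PP\<close> that
      by (simp add: matrix_vector_mult_add_rdistrib inner_add_right flip: scaleR_matrix_vector_assoc)
    ultimately have "pos_def ?R" by (simp add: pos_def_def)
    then show ?thesis unfolding eq using \<mu>(1) by (intro pos_def_scaleR) auto
  qed
  moreover have "\<forall>i\<in>{1..N}. pos_def (Sb i)"
    using Pb \<mu>(1) by (auto simp: Sb_def intro!: pos_def_scaleR pos_def_matrix_inv)
  ultimately show ?thesis by (auto simp: stabilizability_cond_def)
qed

lemma poly_comb_vertex:
  assumes "polytopic PP A N \<xi> Av" "\<pi> \<in> PP" "i \<in> {1..N}" "\<xi> i \<pi> = 1"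
  shows "poly_comb N \<xi> M \<pi> = M i"
proof -
  \<comment> \<open>The weight at \<open>i\<close> uses up the whole sum, and nonnegative weights
    with sum 0 all vanish.\<close>
  have "(\<Sum>j\<in>{1..N} - {i}. \<xi> j \<pi>) = 0"
    using assms sum.remove[of "{1..N}" i "\<lambda>j. \<xi> j \<pi>"] by (simp add: polytopic_def)
  then have "\<xi> j \<pi> = 0" if "j \<in> {1..N} - {i}" for j
    using assms that by (subst (asm) sum_nonneg_eq_0_iff) (auto simp: polytopic_def)
  then have "(\<Sum>j\<in>{1..N} - {i}. \<xi> j \<pi> *\<^sub>R M j) = 0"
    by (intro sum.neutral) auto
  then show ?thesis
    using assms sum.remove[of "{1..N}" i "\<lambda>j. \<xi> j \<pi> *\<^sub>R M j"] by (simp add: poly_comb_def)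
qed

text \<open>The Lyapunov bounds control only the combined matrix; at a parameter where weight
  \<open>i\<close> equals 1 that matrix is \<open>Pb i\<close> itself.\<close>

lemma poly_QLF_vertex_pos_def:
  assumes poly: "polytopic PP A N \<xi> Av" and QLF: "poly_QLF PP N \<xi> Pb F"
    and i: "i \<in> {1..N}" and \<pi>: "\<pi> \<in> PP" "\<xi> i \<pi> = 1"
  shows "pos_def (Pb i)"
proof -
  obtain a1 where a1: "a1 > 0"
    "\<And>x. a1 * (norm x)\<^sup>2 \<le> quad_fun (poly_comb N \<xi> Pb) \<pi> x"
    using QLF \<pi>(1) unfolding poly_QLF_def by blast
  have "0 < x \<bullet> (Pb i *v x)" if "x \<noteq> 0" for x
  proof -
    have "0 < a1 * (norm x)\<^sup>2" using a1(1) that by simp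
    also have "\<dots> \<le> x \<bullet> (Pb i *v x)"
      using a1(2)[of x] by (simp add: quad_fun_def poly_comb_vertex[OF poly \<pi>(1) i \<pi>(2)])
    finally show ?thesis .
  qed
  then show ?thesis using QLF i by (simp add: pos_def_def poly_QLF_def)
qed

text \<open>A poly-QLF has merely symmetric coefficients, whereas the condition involves positive
  definite ones. The first equivalence bridges this by assuming that each weight attains the value
  1, the second by asking for definite coefficients outright; the last conjunct is the explicit
  gain.\<close>

theorem theorem2:
  fixes PP :: "(real^'p) set"
    and A :: "real^'p \<Rightarrow> real^'n^'n"
    and B :: "real^'u^'n"
    and N :: nat
    and \<xi> :: "nat \<Rightarrow> real^'p \<Rightarrow> real"
    and Av :: "nat \<Rightarrow> real^'n^'n"
  assumes "compact PP"
    and "polytopic PP A N \<xi> Av"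
  shows
    "((\<forall>i\<in>{1..N}. \<exists>\<pi>\<in>PP. \<xi> i \<pi> = 1) \<longrightarrow>
        (poly_Q_stabilizable PP N \<xi> A B \<longleftrightarrow> (\<exists>Sb. stabilizability_cond PP N \<xi> A B Sb))) \<and>
     ((\<exists>K Pb. (\<forall>i\<in>{1..N}. pos_def (Pb i)) \<and> poly_QLF PP N \<xi> Pb (closed_loop A B K)) \<longleftrightarrow>
        (\<exists>Sb. stabilizability_cond PP N \<xi> A B Sb)) \<and>
     (\<forall>Sb. stabilizability_cond PP N \<xi> A B Sb \<longrightarrow>
        poly_QLF PP N \<xi> (\<lambda>i. matrix_inv (Sb i)) (closed_loop A B (ctrl_gain N \<xi> A B Sb)))"
proof (intro conjI)
  have gain: "poly_QLF PP N \<xi> (\<lambda>i. matrix_inv (Sb i)) (closed_loop A B (ctrl_gain N \<xi> A B Sb))"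
    if "stabilizability_cond PP N \<xi> A B Sb" for Sb
    using assms that by (rule poly_QLF_ctrl_gain)
  then show "\<forall>Sb. stabilizability_cond PP N \<xi> A B Sb \<longrightarrow>
      poly_QLF PP N \<xi> (\<lambda>i. matrix_inv (Sb i)) (closed_loop A B (ctrl_gain N \<xi> A B Sb))"
    by blast
  have "\<forall>i\<in>{1..N}. pos_def (matrix_inv (Sb i))" if "stabilizability_cond PP N \<xi> A B Sb" for Sb
    using that by (simp add: stabilizability_cond_def pos_def_matrix_inv)
  then have "\<exists>K Pb. (\<forall>i\<in>{1..N}. pos_def (Pb i)) \<and> poly_QLF PP N \<xi> Pb (closed_loop A B K)"
    if "stabilizability_cond PP N \<xi> A B Sb" for Sb
    using gain[OF that] that
    by (intro exI[of _ "ctrl_gain N \<xi> A B Sb"] exI[of _ "\<lambda>i. matrix_inv (Sb i)"]) simp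
  then show iff: "(\<exists>K Pb. (\<forall>i\<in>{1..N}. pos_def (Pb i)) \<and> poly_QLF PP N \<xi> Pb (closed_loop A B K)) \<longleftrightarrow>
      (\<exists>Sb. stabilizability_cond PP N \<xi> A B Sb)"
    using poly_QLF_imp_stabilizability_cond[OF assms] by meson
  \<comment> \<open>After rewriting with the second equivalence, only definiteness of the
    coefficients of a given poly-QLF remains, and the vertices provide it.\<close>
  show "(\<forall>i\<in>{1..N}. \<exists>\<pi>\<in>PP. \<xi> i \<pi> = 1) \<longrightarrow>
      (poly_Q_stabilizable PP N \<xi> A B \<longleftrightarrow> (\<exists>Sb. stabilizability_cond PP N \<xi> A B Sb))"
    unfolding iff[symmetric] poly_Q_stabilizable_def poly_QS_def
    using poly_QLF_vertex_pos_def[OF assms(2)] by blast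
qed

end
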